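(* Let $\theta\in\mathbb{C}$ and let $A$ be a bounded operator on the Fock space $F^2(\mathbb{C})$ whose Wick symbol is $\sigma^W(A)=e^{-\theta|z|^2}$. (1) If $|\theta|^2=2\,\mathrm{Re}(\theta)$ and $\mathrm{Re}(\theta)>1$, then there is no bounded Toeplitz operator $T_\tau$ such that $A=T_\tau$. (2) If $|\theta|^2>2\,\mathrm{Re}(\theta)$, then there is no bounded Toeplitz operator $T_\tau$ with $\tau\in L_1^\infty(\mathbb{R}_+,e^{-r^2})$ such that $A=T_\tau$.
   Context: Let $d\mu(z)=\pi^{-1}e^{-|z|^2}dv(z)$ be the Gaussian measure on $\mathbb{C}$, where $dv$ is Lebesgue measure. The Segal-Bargmann (Fock) space $F^2(\mathbb{C})$ is the closed subspace of entire functions in $L^2(\mathbb{C},d\mu)$, with the $L^2(\mathbb{C},d\mu)$ inner product $\langle\cdot,\cdot\rangle$. For $w\in\mathbb{C}$, the coherent state is $K_w(z)=e^{z\overline{w}}$, and $P:L^2(\mathbb{C},d\mu)\to F^2(\mathbb{C})$ is the orthogonal projection, $Pg(z)=\langle g,K_z\rangle$. The Wick symbol of an operator $A$ on $F^2(\mathbb{C})$ is $$\sigma^W(A)(\overline{v},z)=\frac{\langle AK_v,K_z\rangle}{\langle K_v,K_z\rangle};$$ when it is written as a function of $z$ alone it means its value on the diagonal $v=z$, so $\sigma^W(A)=e^{-\theta|z|^2}$ means $\langle AK_z,K_z\rangle/\langle K_z,K_z\rangle=e^{-\theta|z|^2}$ for all $z\in\mathbb{C}$. For a complex-valued measurable function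 $\tau$ on $\mathbb{C}$, the operator $T_\tau$ is defined by $T_\tau f=P[\tau f]$ with domain $\mathrm{Dom}(T_\tau)=\{f\in F^2(\mathbb{C}):\tau f\in L^2(\mathbb{C},d\mu)\}$. We say that $T_\tau$ is a Toeplitz operator (with anti-Wick symbol $\tau$) if $K_z\in \mathrm{Dom}(T_\tau)$ for all $z\in\mathbb{C}$. $L_1^\infty(\mathbb{R}_+,e^{-r^2})$ is the space of measurable functions $a$ on $\mathbb{R}_+$ with $\int_{\mathbb{R}_+}|a(r)|e^{-r^2}r^n\,dr<\infty$ for all $n\in\mathbb{Z}_+=\{0,1,2,\dots\}$. A function $\tau$ in this space is regarded as the radial symbol $z\mapsto\tau(|z|)$ on $\mathbb{C}$. *)

theory Defs
  imports "HOL-Complex_Analysis.Complex_Analysis"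
begin

definition gauss :: "complex measure" where
  "gauss = density lebesgue (\<lambda>z. ennreal (exp (- (cmod z)\<^sup>2) / pi))"

definition L2 :: "(complex \<Rightarrow> complex) set" where
  "L2 = {f \<in> borel_measurable gauss. integrable gauss (\<lambda>z. (cmod (f z))\<^sup>2)}"

definition L2_inner :: "(complex \<Rightarrow> complex) \<Rightarrow> (complex \<Rightarrow> complex) \<Rightarrow> complex" where
  "L2_inner f g = (LINT z|gauss. f z * cnj (g z))"

definition norm2 :: "(complex \<Rightarrow> complex) \<Rightarrow> real" where
  "norm2 f = sqrt (LINT z|gauss. (cmod (f z))\<^sup>2)"

text \<open>
  Two entire functions that agree almost everywhere are equal, so the Fock space can be
  represented by functions instead of equivalence classes.
\<close>

definition fock :: "(complex \<Rightarrow> complex) set" where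
  "fock = {f. f holomorphic_on UNIV \<and> f \<in> L2}"

definition coherent :: "complex \<Rightarrow> complex \<Rightarrow> complex" where
  "coherent w = (\<lambda>z. exp (z * cnj w))"

text \<open>
  The orthogonal projection of \<^term>\<open>L2\<close> onto \<^term>\<open>fock\<close>, given by the reproducing
  kernel; it is meaningful for arguments in \<^term>\<open>L2\<close> only.
\<close>

definition fock_proj :: "(complex \<Rightarrow> complex) \<Rightarrow> complex \<Rightarrow> complex" where
  "fock_proj g = (\<lambda>z. L2_inner g (coherent z))"

text \<open>
  Operators are total functions, of which only the values on \<^term>\<open>fock\<close> matter.
\<close>

definition bounded_fock_operator :: "((complex \<Rightarrow> complex) \<Rightarrow> (complex \<Rightarrow> complex)) \<Rightarrow> bool" where
  "bounded_fock_operator A \<longleftrightarrow>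
     (\<forall>f\<in>fock. A f \<in> fock) \<and>
     (\<forall>f\<in>fock. \<forall>g\<in>fock. A (\<lambda>z. f z + g z) = (\<lambda>z. A f z + A g z)) \<and>
     (\<forall>c. \<forall>f\<in>fock. A (\<lambda>z. c * f z) = (\<lambda>z. c * A f z)) \<and>
     (\<exists>C. \<forall>f\<in>fock. norm2 (A f) \<le> C * norm2 f)"

text \<open>
  The first argument \<open>u\<close> of the Wick symbol stands for the conjugate of \<open>v\<close>; the diagonal
  \<open>v = z\<close> is therefore \<open>wick_symbol A (cnj z) z\<close>.
\<close>

definition wick_symbol ::
  "((complex \<Rightarrow> complex) \<Rightarrow> (complex \<Rightarrow> complex)) \<Rightarrow> complex \<Rightarrow> complex \<Rightarrow> complex" where
  "wick_symbol A u z =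
     L2_inner (A (coherent (cnj u))) (coherent z) / L2_inner (coherent (cnj u)) (coherent z)"

definition toeplitz_dom :: "(complex \<Rightarrow> complex) \<Rightarrow> (complex \<Rightarrow> complex) set" where
  "toeplitz_dom \<tau> = {f \<in> fock. (\<lambda>z. \<tau> z * f z) \<in> L2}"

definition toeplitz :: "(complex \<Rightarrow> complex) \<Rightarrow> (complex \<Rightarrow> complex) \<Rightarrow> (complex \<Rightarrow> complex)" where
  "toeplitz \<tau> f = fock_proj (\<lambda>z. \<tau> z * f z)"

definition is_toeplitz :: "(complex \<Rightarrow> complex) \<Rightarrow> bool" where
  "is_toeplitz \<tau> \<longleftrightarrow> \<tau> \<in> borel_measurable lebesgue \<and> (\<forall>z. coherent z \<in> toeplitz_dom \<tau>)"

definition bounded_toeplitz :: "(complex \<Rightarrow> complex) \<Rightarrow> bool" where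
  "bounded_toeplitz \<tau> \<longleftrightarrow>
     is_toeplitz \<tau> \<and> (\<exists>C. \<forall>f\<in>toeplitz_dom \<tau>. norm2 (toeplitz \<tau> f) \<le> C * norm2 f)"

text \<open>
  For an unbounded symbol the domain of a bounded Toeplitz operator can be a proper dense
  subspace of \<^term>\<open>fock\<close> (it contains all coherent states). An everywhere defined bounded
  operator equals it if it is its unique bounded extension, that is, if the two agree on that
  domain. Equality together with full domain is the special case
  \<^term>\<open>toeplitz_dom \<tau> = fock\<close>.
\<close>

definition equals_toeplitz ::
  "((complex \<Rightarrow> complex) \<Rightarrow> (complex \<Rightarrow> complex)) \<Rightarrow> (complex \<Rightarrow> complex) \<Rightarrow> bool" where
  "equals_toeplitz A \<tau> \<longleftrightarrow> (\<forall>f\<in>toeplitz_dom \<tau>. A f = toeplitz \<tau> f)"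

definition L1_infty :: "(real \<Rightarrow> complex) set" where
  "L1_infty = {a. set_borel_measurable lebesgue {0..} a \<and>
     (\<forall>n::nat. set_integrable lebesgue {0..} (\<lambda>r. cmod (a r) * exp (- r\<^sup>2) * r ^ n))}"

definition radial :: "(real \<Rightarrow> complex) \<Rightarrow> complex \<Rightarrow> complex" where
  "radial a = (\<lambda>z. a (cmod z))"

end

theory Submission
  imports Defs "HOL-Probability.Distributions"
begin

text \<open>
  Suppose that \<open>A\<close> agrees with a Toeplitz operator of symbol \<open>\<tau>\<close>, and write \<open>l = 1 - \<theta>\<close>.
  The function \<open>k(w, z) = (A K\<^sub>w)(z)\<close> is the Laplace transform
  \<open>\<integral> \<tau>(u) exp (u cnj w + cnj u z) d\<mu>(u)\<close>. By the Wick symbol and the reproducing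
  property (\<open>L2_inner_fock_proj\<close>), \<open>k(z, z) = exp (l \<bar>z\<bar>\<^sup>2)\<close>. The transform extends
  to an entire function of each of its two real frequencies, so it is determined by the diagonal (\<open>gauss_laplace_eqI\<close>), and
  \<open>k(w, z) = exp (l z cnj w)\<close> for all \<open>w\<close> and \<open>z\<close>: \<open>A\<close> acts on coherent states as the
  dilation by \<open>l\<close>.

  Two necessary conditions follow. For \<open>z = - w\<close> the exponentials under the integral are
  unimodular, so \<open>exp (- l \<bar>w\<bar>\<^sup>2)\<close> is bounded by the norm of \<open>\<tau>\<close> in \<open>L\<^sup>1(\<mu>)\<close>, which forces
  \<open>Re l \<ge> 0\<close>, that is \<open>Re \<theta> \<le> 1\<close> (\<open>Re_nonneg_of_gauss_laplace\<close>). And since \<open>A\<close> is bounded,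
  \<open>\<bar>k(w, z)\<bar>\<close> is at most a constant times \<open>exp ((\<bar>w\<bar>\<^sup>2 + \<bar>z\<bar>\<^sup>2) / 2)\<close>, which forces
  \<open>\<bar>l\<bar> \<le> 1\<close> (\<open>cmod_le_one_of_toeplitz_coherent\<close>); as \<open>\<bar>1 - \<theta>\<bar>\<^sup>2 = 1 - 2 Re \<theta> + \<bar>\<theta>\<bar>\<^sup>2\<close>, this says
  \<open>\<bar>\<theta>\<bar>\<^sup>2 \<le> 2 Re \<theta>\<close>. The first condition fails in the first claim and the second condition in the
  second claim.
\<close>

section \<open>Entire functions given by exponential integrals\<close>

text \<open>
  Expanding the exponential and integrating term by term gives a power series that converges
  everywhere. The interchange is allowed because the partial sums of the absolute values
  are dominated by \<open>\<bar>g\<bar> exp (\<bar>x\<bar> \<bar>\<phi>\<bar>)\<close>.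
\<close>

lemma holomorphic_on_integral_exp:
  fixes g :: "'a \<Rightarrow> complex" and \<phi> :: "'a \<Rightarrow> real"
  assumes [measurable]: "g \<in> borel_measurable M" "\<phi> \<in> borel_measurable M"
    and int: "\<And>r. integrable M (\<lambda>u. cmod (g u) * exp (r * \<bar>\<phi> u\<bar>))"
  shows "(\<lambda>x. LINT u|M. g u * exp (x * of_real (\<phi> u))) holomorphic_on UNIV"
proof -
  define c where "c n = (LINT u|M. g u * (of_real (\<phi> u) ^ n / fact n))" for n
  have sums: "(\<lambda>n. c n * x ^ n) sums (LINT u|M. g u * exp (x * of_real (\<phi> u)))" for x
  proof -
    let ?f = "\<lambda>n u. g u * ((x * of_real (\<phi> u)) ^ n / fact n)"
    have exp_series: "(\<lambda>n. \<bar>y\<bar> ^ n / fact n) sums exp \<bar>y\<bar>" for y :: real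
      using exp_converges[of "\<bar>y\<bar>"] by (simp add: divide_inverse mult.commute)
    have partial_le: "(\<Sum>n<N. cmod (?f n u)) \<le> cmod (g u) * exp (cmod x * \<bar>\<phi> u\<bar>)" for N u
    proof -
      have "(\<Sum>n<N. \<bar>cmod x * \<phi> u\<bar> ^ n / fact n) \<le> exp \<bar>cmod x * \<phi> u\<bar>"
        using sum_le_suminf[OF sums_summable[OF exp_series[of "cmod x * \<phi> u"]], of "{..<N}"]
          sums_unique[OF exp_series[of "cmod x * \<phi> u"]] by auto
      then have "cmod (g u) * (\<Sum>n<N. \<bar>cmod x * \<phi> u\<bar> ^ n / fact n) \<le> cmod (g u) * exp \<bar>cmod x * \<phi> u\<bar>"
        by (intro mult_left_mono) auto
      then show ?thesis
        by (simp add: sum_distrib_left norm_mult norm_divide norm_power abs_mult)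
    qed
    have term_le: "cmod (?f n u) \<le> cmod (g u) * exp (cmod x * \<bar>\<phi> u\<bar>)" for n u
      using partial_le[of u "Suc n"] sum_nonneg[of "{..<n}" "\<lambda>n. cmod (?f n u)"] by simp
    have int_f: "integrable M (?f n)" for n
      by (rule Bochner_Integration.integrable_bound[OF int[of "cmod x"]]) 
        (use term_le in \<open>auto intro!: AE_I2\<close>)
    have summable_f: "summable (\<lambda>n. cmod (?f n u))" for u
    proof -
      have "summable (\<lambda>n. cmod (g u) * (\<bar>cmod x * \<phi> u\<bar> ^ n / fact n))"
        by (rule summable_mult) (rule sums_summable[OF exp_series])
      then show ?thesis
        by (simp add: norm_mult norm_divide norm_power abs_mult)
    qed
    have summable_int: "summable (\<lambda>n. LINT u|M. cmod (?f n u))"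
    proof (rule summableI_nonneg_bounded)
      fix N
      have "(\<Sum>n<N. LINT u|M. cmod (?f n u)) = (LINT u|M. (\<Sum>n<N. cmod (?f n u)))"
        using int_f by (subst Bochner_Integration.integral_sum) auto
      also have "\<dots> \<le> (LINT u|M. cmod (g u) * exp (cmod x * \<bar>\<phi> u\<bar>))"
        by (intro integral_mono int Bochner_Integration.integrable_sum integrable_norm int_f partial_le)
      finally show "(\<Sum>n<N. LINT u|M. cmod (?f n u)) \<le> \<dots>" .
    qed auto
    have "(\<lambda>n. LINT u|M. ?f n u) sums (LINT u|M. (\<Sum>n. ?f n u))"
      by (rule sums_integral) (use int_f summable_f summable_int in auto)
    moreover have "(LINT u|M. ?f n u) = c n * x ^ n" for n
    proof -
      have "(LINT u|M. ?f n u) = (LINT u|M. (g u * (of_real (\<phi> u) ^ n / fact n)) * x ^ n)"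
        by (intro Bochner_Integration.integral_cong refl) (simp add: power_mult_distrib mult_ac)
      then show ?thesis unfolding c_def by simp
    qed
    moreover have "(\<Sum>n. ?f n u) = g u * exp (x * of_real (\<phi> u))" for u
      using exp_converges[of "x * of_real (\<phi> u)"] summable_exp[of "x * of_real (\<phi> u)"]
      by (subst suminf_mult) (auto simp: sums_iff scaleR_conv_of_real divide_inverse mult.commute)
    ultimately show ?thesis by simp
  qed
  have "((\<lambda>x. \<Sum>n. c n * x ^ n) has_field_derivative (\<Sum>n. diffs c n * x ^ n)) (at x)" for x
    by (rule termdiffs_strong_converges_everywhere) (rule sums_summable[OF sums])
  then have "(\<lambda>x. \<Sum>n. c n * x ^ n) holomorphic_on UNIV"
    by (auto simp: holomorphic_on_open)
  also have "(\<lambda>x. \<Sum>n. c n * x ^ n) = (\<lambda>x. LINT u|M. g u * exp (x * of_real (\<phi> u)))"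
    by (rule ext) (rule sums_unique[OF sums, symmetric])
  finally show ?thesis .
qed

lemma entire_eqI_real:
  assumes "f holomorphic_on UNIV" "g holomorphic_on UNIV"
    and eq: "\<And>x::real. f (of_real x) = g (of_real x)"
  shows "f z = g z"
proof -
  have "f z - g z = 0"
  proof (rule analytic_continuation[of "\<lambda>z. f z - g z" UNIV "range complex_of_real" 0])
    show "0 islimpt range complex_of_real"
    proof (clarsimp simp: islimpt_approachable)
      fix e :: real assume "e > 0"
      then show "\<exists>x. x \<noteq> 0 \<and> \<bar>x\<bar> < e"
        by (intro exI[of _ "e/2"]) auto
    qed
  qed (use assms in \<open>auto intro!: holomorphic_intros\<close>)
  then show ?thesis by simp
qed

section \<open>Gaussian integrals over the plane\<close>

text \<open>
  The integrand is a product of two normal densities of variance \<open>s / 2\<close>, one in each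
  coordinate. The width \<open>s\<close> is \<open>1\<close> for the Gaussian measure itself and \<open>2\<close> for the
  integrability of \<open>exp (\<bar>z\<bar>\<^sup>2 / 2)\<close> against it.
\<close>

lemma nn_integral_gaussian_complex:
  fixes c :: complex
  assumes "s > 0"
  shows "(\<integral>\<^sup>+z. ennreal (exp (- (cmod (z - c))\<^sup>2 / s) / (pi * s)) \<partial>lborel) = 1"
proof -
  define \<sigma> where "\<sigma> = sqrt (s / 2)"
  have \<sigma>: "\<sigma> > 0" "2 * \<sigma>\<^sup>2 = s"
    using assms by (auto simp: \<sigma>_def)
  have "exp (- (cmod (z - c))\<^sup>2 / s) / (pi * s) =
      (\<Prod>b\<in>Basis. normal_density (c \<bullet> b) \<sigma> (z \<bullet> b))" for z
    unfolding Basis_complex_def normal_density_def \<open>2 * \<sigma>\<^sup>2 = s\<close>[symmetric]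
    using \<sigma> assms
    by (simp add: inner_complex_def cmod_power2 exp_add[symmetric] add_divide_distrib diff_divide_distrib real_sqrt_mult algebra_simps)
  then have "(\<integral>\<^sup>+z. ennreal (exp (- (cmod (z - c))\<^sup>2 / s) / (pi * s)) \<partial>lborel) =
      (\<integral>\<^sup>+z. (\<Prod>b\<in>Basis. ennreal (normal_density (c \<bullet> b) \<sigma> (z \<bullet> b))) \<partial>lborel)"
    by (simp add: prod_ennreal)
  also have "\<dots> = (\<Prod>b\<in>Basis. \<integral>\<^sup>+x. ennreal (normal_density (c \<bullet> b) \<sigma> x) \<partial>lborel)"
    by (rule nn_integral_lborel_prod) auto
  also have "\<dots> = 1"
    using \<sigma> by (simp add: nn_integral_eq_integral)
  finally show ?thesis .
qed

lemma sets_gauss [measurable_cong, simp]: "sets gauss = sets lebesgue"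
  by (simp add: gauss_def)

lemma space_gauss [simp]: "space gauss = UNIV"
  by (simp add: gauss_def)

lemma nn_integral_gauss:
  assumes [measurable]: "f \<in> borel_measurable borel"
  shows "(\<integral>\<^sup>+z. f z \<partial>gauss) = (\<integral>\<^sup>+z. ennreal (exp (- (cmod z)\<^sup>2) / pi) * f z \<partial>lborel)"
proof -
  have f: "f \<in> borel_measurable lebesgue"
    using assms by (auto intro: measurable_completion)
  have "(\<lambda>z::complex. ennreal (exp (- (cmod z)\<^sup>2) / pi)) \<in> borel_measurable lebesgue"
    by (intro measurable_completion) simp
  then show ?thesis unfolding gauss_def using f
    by (subst nn_integral_density) (auto simp: nn_integral_completion)
qed

lemma borel_measurable_gauss:
  "f \<in> borel_measurable borel \<Longrightarrow> f \<in> borel_measurable gauss"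
  by (auto simp: gauss_def intro: measurable_completion)

text \<open>
  Completing the square turns the integrand into the Gaussian density centred at \<open>x + \<i> y\<close>.
\<close>

lemma nn_integral_gauss_exp:
  "(\<integral>\<^sup>+u. ennreal (exp (2 * x * Re u + 2 * y * Im u)) \<partial>gauss) = ennreal (exp (x\<^sup>2 + y\<^sup>2))"
proof -
  have "ennreal (exp (- (cmod u)\<^sup>2) / pi) * ennreal (exp (2 * x * Re u + 2 * y * Im u)) =
      ennreal (exp (x\<^sup>2 + y\<^sup>2)) * ennreal (exp (- (cmod (u - Complex x y))\<^sup>2 / 1) / (pi * 1))" for u
    by (simp add: ennreal_mult[symmetric] exp_add[symmetric] cmod_power2 power2_diff algebra_simps)
  then show ?thesis
    using nn_integral_gaussian_complex[of 1 "Complex x y"]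
    by (subst nn_integral_gauss) (simp_all add: nn_integral_cmult)
qed

lemma integrable_gauss_exp: "integrable gauss (\<lambda>u. exp (2 * x * Re u + 2 * y * Im u))"
  and integral_gauss_exp: "(LINT u|gauss. exp (2 * x * Re u + 2 * y * Im u)) = exp (x\<^sup>2 + y\<^sup>2)"
  using nn_integral_gauss_exp[of x y]
  by (subst (asm) nn_integral_eq_integrable; simp add: borel_measurable_gauss)+

lemma prob_space_gauss: "prob_space gauss"
proof
  show "emeasure gauss (space gauss) = 1"
    using nn_integral_gauss_exp[of 0 0] by (simp add: nn_integral_const)
qed

section \<open>Square integrable functions and coherent states\<close>

lemma integrable_norm_mult_L2:
  assumes "f \<in> L2" "g \<in> L2"
  shows "integrable gauss (\<lambda>u. cmod (f u) * cmod (g u))"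
proof (rule Bochner_Integration.integrable_bound)
  show "integrable gauss (\<lambda>u. (cmod (f u))\<^sup>2 + (cmod (g u))\<^sup>2)"
    using assms by (auto simp: L2_def)
  show "(\<lambda>u. cmod (f u) * cmod (g u)) \<in> borel_measurable gauss"
    using assms by (auto simp: L2_def)
  have "a * b \<le> a\<^sup>2 + b\<^sup>2" if "a \<ge> 0" "b \<ge> 0" for a b :: real
    using sum_squares_bound[of a b] mult_nonneg_nonneg[OF that] by linarith
  then show "AE u in gauss. norm (cmod (f u) * cmod (g u)) \<le> norm ((cmod (f u))\<^sup>2 + (cmod (g u))\<^sup>2)"
    by auto
qed

lemma norm_L2_inner_le:
  assumes f: "f \<in> L2" and g: "g \<in> L2"
  shows "cmod (L2_inner f g) \<le> norm2 f * norm2 g"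
proof -
  have [measurable]: "f \<in> borel_measurable gauss" "g \<in> borel_measurable gauss"
    using f g by (auto simp: L2_def)
  define I where "I = (LINT u|gauss. cmod (f u) * cmod (g u))"
  have sq: "(\<integral>\<^sup>+u. (ennreal (cmod (h u)))\<^sup>2 \<partial>gauss) = ennreal ((norm2 h)\<^sup>2)" if "h \<in> L2" for h
    using that by (simp add: L2_def norm2_def ennreal_power nn_integral_eq_integral)
  have "ennreal I = (\<integral>\<^sup>+u. ennreal (cmod (f u)) * ennreal (cmod (g u)) \<partial>gauss)"
    unfolding I_def using integrable_norm_mult_L2[OF f g]
    by (subst nn_integral_eq_integral[symmetric]) (auto simp: ennreal_mult)
  then have "(ennreal I)\<^sup>2 \<le> ennreal ((norm2 f)\<^sup>2) * ennreal ((norm2 g)\<^sup>2)"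
    using Cauchy_Schwarz_nn_integral[of "\<lambda>u. ennreal (cmod (f u))" gauss "\<lambda>u. ennreal (cmod (g u))"]
    by (simp add: sq f g)
  moreover have "I \<ge> 0"
    unfolding I_def by simp
  ultimately have "I\<^sup>2 \<le> (norm2 f * norm2 g)\<^sup>2"
    by (simp add: ennreal_power ennreal_mult[symmetric] power_mult_distrib)
  then have "I \<le> norm2 f * norm2 g"
    by (rule power2_le_imp_le) (simp add: norm2_def)
  moreover have "cmod (L2_inner f g) \<le> I"
    unfolding L2_inner_def I_def
    using integral_norm_bound[of gauss "\<lambda>u. f u * cnj (g u)"] by (simp add: norm_mult)
  ultimately show ?thesis by simp
qed

lemma L2_coherent: "coherent w \<in> L2"
  and norm2_coherent: "norm2 (coherent w) = exp ((cmod w)\<^sup>2 / 2)"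
proof -
  have sq: "(cmod (coherent w u))\<^sup>2 = exp (2 * Re w * Re u + 2 * Im w * Im u)" for u
    by (simp add: coherent_def exp_double[symmetric] algebra_simps)
  have "coherent w \<in> borel_measurable gauss"
    unfolding coherent_def by (rule borel_measurable_gauss) measurable
  then show "coherent w \<in> L2"
    unfolding L2_def using integrable_gauss_exp by (simp add: sq)
  have "norm2 (coherent w) = sqrt (exp ((cmod w)\<^sup>2))"
    unfolding norm2_def sq integral_gauss_exp by (simp add: cmod_power2)
  also have "\<dots> = sqrt ((exp ((cmod w)\<^sup>2 / 2))\<^sup>2)"
    by (simp add: exp_double[symmetric])
  finally show "norm2 (coherent w) = exp ((cmod w)\<^sup>2 / 2)"
    by simp
qed

section \<open>The two-sided Laplace transform of a symbol\<close>

text \<open>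
  The Laplace transform of \<open>\<tau> \<mu>\<close> on the plane in real coordinates, with complex frequencies.
  With \<open>p = x - \<i> y\<close> and \<open>q = x + \<i> y\<close> the exponent is \<open>p u + q cnj u\<close>, and
  \<open>x\<^sup>2 + y\<^sup>2 = p q\<close>. Real coordinates are used because \<open>x\<close> and \<open>y\<close> can then be continued
  from the reals independently of each other; on the diagonal of a kernel \<open>p\<close> and \<open>q\<close>
  are conjugate.
\<close>

definition gauss_laplace :: "(complex \<Rightarrow> complex) \<Rightarrow> complex \<Rightarrow> complex \<Rightarrow> complex" where
  "gauss_laplace \<tau> x y = (LINT u|gauss. \<tau> u * exp (2 * x * Re u + 2 * y * Im u))"

lemma L2_inner_coherent_eq_gauss_laplace:
  "L2_inner (\<lambda>u. \<tau> u * coherent w u) (coherent z) =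
     gauss_laplace \<tau> ((cnj w + z) / 2) (\<i> * (cnj w - z) / 2)"
proof -
  have "u * cnj w + cnj u * z =
      2 * ((cnj w + z) / 2) * Re u + 2 * (\<i> * (cnj w - z) / 2) * Im u" for u
    by (simp add: complex_eq_iff field_simps)
  then show ?thesis
    unfolding L2_inner_def gauss_laplace_def coherent_def
    by (simp add: exp_cnj exp_add[symmetric] mult.assoc)
qed

text \<open>
  The uniqueness of the analytic continuation, applied first in \<open>x\<close> with \<open>y\<close> real, then in
  \<open>y\<close> with \<open>x\<close> complex. For kernels it is the statement that the values on the diagonal
  determine the kernel.
\<close>

lemma gauss_laplace_eqI:
  assumes [measurable]: "\<tau> \<in> borel_measurable gauss"
    and int: "\<And>s t. integrable gauss (\<lambda>u. cmod (\<tau> u) * exp (2 * s * Re u) * exp (2 * t * Im u))"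
    and real: "\<And>s t::real. gauss_laplace \<tau> s t = exp (l * (of_real s ^ 2 + of_real t ^ 2))"
  shows "gauss_laplace \<tau> x y = exp (l * (x\<^sup>2 + y\<^sup>2))"
proof -
  have [measurable]: "Re \<in> borel_measurable gauss" "Im \<in> borel_measurable gauss"
    by (auto intro!: borel_measurable_gauss)
  have dominated: "integrable gauss (\<lambda>u. h u * exp (r * \<bar>a u\<bar>))"
    if [measurable]: "h \<in> borel_measurable gauss" "a \<in> borel_measurable gauss" and "\<And>u. h u \<ge> 0"
      and int_h: "\<And>r. integrable gauss (\<lambda>u. h u * exp (r * a u))"
    for h a :: "complex \<Rightarrow> real" and r
  proof (rule Bochner_Integration.integrable_bound)
    show "integrable gauss (\<lambda>u. h u * exp (r * a u) + h u * exp (- r * a u))"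
      by (intro Bochner_Integration.integrable_add int_h)
    have "h u * exp (r * \<bar>a u\<bar>) \<le> h u * exp (r * a u) + h u * exp (- r * a u)" for u
      using \<open>h u \<ge> 0\<close> by (cases "a u \<ge> 0") auto
    then show "AE u in gauss. norm (h u * exp (r * \<bar>a u\<bar>)) \<le>
        norm (h u * exp (r * a u) + h u * exp (- r * a u))"
      using \<open>\<And>u. h u \<ge> 0\<close> by (intro AE_I2) (simp add: add_nonneg_nonneg)
  qed measurable
  have hol_x: "(\<lambda>x. gauss_laplace \<tau> x y) holomorphic_on UNIV" for y
  proof -
    have "(\<lambda>x. LINT u|gauss. (\<tau> u * exp (2 * y * Im u)) * exp (x * of_real (2 * Re u))) holomorphic_on UNIV"
    proof (intro holomorphic_on_integral_exp dominated)
      show "integrable gauss (\<lambda>u. cmod (\<tau> u * exp (2 * y * Im u)) * exp (r * (2 * Re u)))" for r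
        using int[of r "Re y"] by (simp add: norm_mult mult_ac)
    qed auto
    then show ?thesis
      unfolding gauss_laplace_def by (simp add: exp_add mult_ac)
  qed
  have hol_y: "(\<lambda>y. gauss_laplace \<tau> x y) holomorphic_on UNIV" for x
  proof -
    have "(\<lambda>y. LINT u|gauss. (\<tau> u * exp (2 * x * Re u)) * exp (y * of_real (2 * Im u))) holomorphic_on UNIV"
    proof (intro holomorphic_on_integral_exp dominated)
      show "integrable gauss (\<lambda>u. cmod (\<tau> u * exp (2 * x * Re u)) * exp (r * (2 * Im u)))" for r
        using int[of "Re x" r] by (simp add: norm_mult mult_ac)
    qed auto
    then show ?thesis
      unfolding gauss_laplace_def by (simp add: exp_add mult_ac)
  qed
  have "gauss_laplace \<tau> x (of_real t) = exp (l * (x\<^sup>2 + (of_real t)\<^sup>2))" for x and t :: real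
    by (rule entire_eqI_real[where z = x and f = "\<lambda>x. gauss_laplace \<tau> x t"])
      (auto intro!: hol_x holomorphic_intros real)
  then show ?thesis
    by (intro entire_eqI_real[where z = y and f = "\<lambda>y. gauss_laplace \<tau> x y"])
      (auto intro!: hol_y holomorphic_intros)
qed

text \<open>
  The symbol \<open>1\<close> has the transform \<open>exp (x\<^sup>2 + y\<^sup>2)\<close> at real arguments, hence everywhere.
\<close>

lemma L2_inner_coherent_coherent: "L2_inner (coherent w) (coherent z) = exp (cnj w * z)"
proof -
  have "gauss_laplace (\<lambda>u. 1) x y = exp (1 * (x\<^sup>2 + y\<^sup>2))" for x y
  proof (rule gauss_laplace_eqI)
    fix s t :: real
    have "gauss_laplace (\<lambda>u. 1) s t = of_real (LINT u|gauss. exp (2 * s * Re u + 2 * t * Im u))"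
      unfolding gauss_laplace_def by (subst integral_complex_of_real[symmetric]) (simp flip: exp_of_real del: integral_complex_of_real)
    then show "gauss_laplace (\<lambda>u. 1) s t = exp (1 * (of_real s ^ 2 + of_real t ^ 2))"
      by (simp add: integral_gauss_exp flip: exp_of_real)
  qed (use integrable_gauss_exp in \<open>auto simp: exp_add\<close>)
  from this[of "(cnj w + z) / 2" "\<i> * (cnj w - z) / 2"] show ?thesis
    using L2_inner_coherent_eq_gauss_laplace[of "\<lambda>u. 1" w z]
    by (simp add: power2_eq_square field_simps)
qed

section \<open>The reproducing property of the projection\<close>

text \<open>
  Integrating \<open>\<bar>exp (cnj s * u) * exp (cnj u * z)\<bar>\<close> over \<open>u\<close> gives \<open>exp (\<bar>s + z\<bar>\<^sup>2 / 4)\<close>.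
  Its product with any \<open>\<bar>g s\<bar>\<close>, \<open>g \<in> L2\<close>, is therefore integrable, and Fubini applies to the
  double integral in the reproducing property.
\<close>

lemma L2_exp_square: "(\<lambda>s. of_real (exp ((cmod (s + z))\<^sup>2 / 4))) \<in> L2"
proof -
  have sq: "(exp ((cmod (s + z))\<^sup>2 / 4))\<^sup>2 = exp ((cmod (s + z))\<^sup>2 / 2)" for s
    by (simp add: exp_double[symmetric])
  have "ennreal (exp (- (cmod s)\<^sup>2) / pi) * ennreal (exp ((cmod (s + z))\<^sup>2 / 2)) =
      ennreal (2 * exp ((cmod z)\<^sup>2)) * ennreal (exp (- (cmod (s - z))\<^sup>2 / 2) / (pi * 2))" for s
    by (simp add: ennreal_mult[symmetric] exp_add[symmetric] cmod_power2)
      (simp add: power2_eq_square field_simps)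
  then have "(\<integral>\<^sup>+s. ennreal (exp ((cmod (s + z))\<^sup>2 / 2)) \<partial>gauss) = ennreal (2 * exp ((cmod z)\<^sup>2))"
    using nn_integral_gaussian_complex[of 2 z]
    by (subst nn_integral_gauss) (simp_all add: nn_integral_cmult)
  then have "integrable gauss (\<lambda>s. exp ((cmod (s + z))\<^sup>2 / 2))"
    by (subst (asm) nn_integral_eq_integrable) (auto intro!: borel_measurable_gauss)
  then show ?thesis
    by (auto simp: L2_def sq intro!: borel_measurable_gauss)
qed

text \<open>
  The left side is a double integral of \<open>g s * (cnj (coherent u s) * cnj (coherent z u))\<close>.
  Exchanging the integrals, the inner one becomes the inner product of two coherent states,
  which is again the kernel.
\<close>

lemma L2_inner_fock_proj:
  assumes g: "g \<in> L2"
  shows "L2_inner (fock_proj g) (coherent z) = L2_inner g (coherent z)"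
proof -
  interpret prob_space gauss by (rule prob_space_gauss)
  interpret pair_sigma_finite gauss gauss by standard
  define F where "F s u = g s * (exp (cnj s * u) * exp (cnj u * z))" for s u
  have g_meas: "g \<in> borel_measurable gauss" and id: "(\<lambda>u. u) \<in> borel_measurable gauss"
    using g by (auto simp: L2_def intro!: borel_measurable_gauss)
  have kernel: "(\<lambda>p. exp (cnj (a p) * b p) * exp (cnj (b p) * z)) \<in> borel_measurable N"
    if [measurable]: "a \<in> borel_measurable N" "b \<in> borel_measurable N"
    for a b and N :: "'b measure"
  proof -
    have [measurable]: "cnj \<in> borel_measurable borel"
      by (intro borel_measurable_continuous_onI continuous_intros)
    show ?thesis by measurable
  qed
  have norm_F: "cmod (F s u) = cmod (g s) * exp (2 * (Re (s + z) / 2) * Re u + 2 * (Im (s + z) / 2) * Im u)" for s u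
    by (simp add: F_def norm_mult exp_add[symmetric] field_simps)
  have int_F: "integrable gauss (F s)" for s
  proof (rule Bochner_Integration.integrable_bound)
    show "integrable gauss (\<lambda>u. cmod (g s) * exp (2 * (Re (s + z) / 2) * Re u + 2 * (Im (s + z) / 2) * Im u))"
      by (intro integrable_mult_right integrable_gauss_exp)
    show "F s \<in> borel_measurable gauss"
      unfolding F_def by (intro borel_measurable_times borel_measurable_const kernel id)
  qed (simp add: norm_F)
  have "integrable (gauss \<Otimes>\<^sub>M gauss) (\<lambda>(s, u). F s u)"
  proof (rule Fubini_integrable)
    show "(\<lambda>(s, u). F s u) \<in> borel_measurable (gauss \<Otimes>\<^sub>M gauss)"
      unfolding F_def case_prod_beta
      by (intro borel_measurable_times kernel measurable_compose[OF measurable_fst g_meas]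
          measurable_compose[OF measurable_fst id] measurable_compose[OF measurable_snd id])
    have "(LINT u|gauss. cmod (F s u)) = cmod (g s) * cmod (of_real (exp ((cmod (s + z))\<^sup>2 / 4)))" for s
      unfolding norm_F integral_mult_right_zero integral_gauss_exp
      by (simp add: cmod_power2 power_divide flip: add_divide_distrib)
    then show "integrable gauss (\<lambda>s. LINT u|gauss. cmod (case (s, u) of (s, u) \<Rightarrow> F s u))"
      using integrable_norm_mult_L2[OF g L2_exp_square] by simp
    show "AE s in gauss. integrable gauss (\<lambda>u. case (s, u) of (s, u) \<Rightarrow> F s u)"
      using int_F by simp
  qed
  then have swap: "(LINT u|gauss. LINT s|gauss. F s u) = (LINT s|gauss. LINT u|gauss. F s u)"
    by (rule Fubini_integral)
  have inner_u: "(LINT u|gauss. F s u) = g s * cnj (coherent z s)" for s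
  proof -
    have "(LINT u|gauss. F s u) = g s * L2_inner (coherent s) (coherent z)"
      unfolding F_def L2_inner_def coherent_def by (simp add: exp_cnj mult_ac)
    then show ?thesis
      unfolding L2_inner_coherent_coherent by (simp add: coherent_def exp_cnj)
  qed
  have inner_s: "(LINT s|gauss. F s u) = fock_proj g u * cnj (coherent z u)" for u
  proof -
    have "fock_proj g u * cnj (coherent z u) = (LINT s|gauss. g s * exp (cnj s * u)) * exp (cnj u * z)"
      by (simp add: fock_proj_def L2_inner_def coherent_def exp_cnj)
    also have "\<dots> = (LINT s|gauss. F s u)"
      unfolding F_def by (subst integral_mult_left_zero[symmetric]) (simp add: mult_ac)
    finally show ?thesis ..
  qed
  show ?thesis
    using swap unfolding inner_u inner_s L2_inner_def .
qed

section \<open>Toeplitz operators with a Gaussian Wick symbol\<close>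

lemma toeplitz_coherent_eq_gauss_laplace:
  "toeplitz \<tau> (coherent w) z = gauss_laplace \<tau> ((cnj w + z) / 2) (\<i> * (cnj w - z) / 2)"
  unfolding toeplitz_def fock_proj_def by (rule L2_inner_coherent_eq_gauss_laplace)

lemma L2_inner_toeplitz_coherent:
  assumes "is_toeplitz \<tau>"
  shows "L2_inner (toeplitz \<tau> (coherent w)) (coherent z) = toeplitz \<tau> (coherent w) z"
proof -
  have "(\<lambda>u. \<tau> u * coherent w u) \<in> L2"
    using assms by (auto simp: is_toeplitz_def toeplitz_dom_def)
  from L2_inner_fock_proj[OF this] show ?thesis
    by (simp add: toeplitz_def fock_proj_def)
qed

lemma is_toeplitz_integrable_exp:
  assumes "is_toeplitz \<tau>"
  shows "integrable gauss (\<lambda>u. cmod (\<tau> u) * exp (2 * s * Re u) * exp (2 * t * Im u))"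
proof -
  have "(\<lambda>u. \<tau> u * coherent (Complex (2 * s) (2 * t)) u) \<in> L2"
    using assms by (auto simp: is_toeplitz_def toeplitz_dom_def)
  from integrable_norm_mult_L2[OF this L2_coherent[of 0]] show ?thesis
    by (simp add: coherent_def norm_mult exp_add mult_ac)
qed

text \<open>
  The Wick symbol prescribes the transform at real \<open>x\<close> and \<open>y\<close>, namely at \<open>x + \<i> y = z\<close>;
  the factor \<open>exp (\<bar>z\<bar>\<^sup>2)\<close> from the normalisation turns \<open>- \<theta>\<close> into \<open>1 - \<theta>\<close>.
\<close>

lemma toeplitz_wick_gaussian_symbol:
  assumes wick: "\<And>z. wick_symbol A (cnj z) z = exp (- \<theta> * complex_of_real ((cmod z)\<^sup>2))"
    and toeplitz: "is_toeplitz \<tau>"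
    and eq: "equals_toeplitz A \<tau>"
  shows "gauss_laplace \<tau> x y = exp ((1 - \<theta>) * (x\<^sup>2 + y\<^sup>2))"
proof (rule gauss_laplace_eqI)
  show "\<tau> \<in> borel_measurable gauss"
    using toeplitz by (auto simp: is_toeplitz_def gauss_def)
  show "integrable gauss (\<lambda>u. cmod (\<tau> u) * exp (2 * s * Re u) * exp (2 * t * Im u))" for s t
    using toeplitz by (rule is_toeplitz_integrable_exp)
  fix s t :: real
  define z where "z = Complex s t"
  have A: "A (coherent z) = toeplitz \<tau> (coherent z)"
    using toeplitz eq by (auto simp: is_toeplitz_def equals_toeplitz_def)
  have "toeplitz \<tau> (coherent z) z / exp (of_real ((cmod z)\<^sup>2)) = exp (- \<theta> * of_real ((cmod z)\<^sup>2))"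
    using wick[of z] A L2_inner_toeplitz_coherent[OF toeplitz, of z z]
    by (simp add: wick_symbol_def L2_inner_coherent_coherent complex_norm_square[symmetric] mult.commute del: of_real_power)
  then have "toeplitz \<tau> (coherent z) z = exp ((1 - \<theta>) * of_real ((cmod z)\<^sup>2))"
    by (simp add: field_simps exp_diff exp_minus del: of_real_power)
  moreover have "(cnj z + z) / 2 = of_real s" "\<i> * (cnj z - z) / 2 = of_real t"
    by (auto simp: complex_eq_iff z_def)
  ultimately show "gauss_laplace \<tau> s t = exp ((1 - \<theta>) * (of_real s ^ 2 + of_real t ^ 2))"
    by (simp add: toeplitz_coherent_eq_gauss_laplace cmod_power2 z_def)
qed

text \<open>
  At imaginary frequencies the transform is a Fourier transform of \<open>\<tau> \<mu>\<close>, bounded by the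
  integral of \<open>\<bar>\<tau>\<bar>\<close>. But \<open>\<bar>exp (l (\<i> t)\<^sup>2)\<bar> = exp (- Re l t\<^sup>2)\<close> grows without bound if \<open>Re l\<close>
  is negative.
\<close>

lemma Re_nonneg_of_gauss_laplace:
  assumes laplace: "\<And>x y. gauss_laplace \<tau> x y = exp (l * (x\<^sup>2 + y\<^sup>2))"
  shows "Re l \<ge> 0"
proof (rule ccontr)
  assume neg: "\<not> Re l \<ge> 0"
  define C where "C = (LINT u|gauss. cmod (\<tau> u))"
  have le: "1 + - Re l * t\<^sup>2 \<le> C" for t :: real
  proof -
    have "1 + - Re l * t\<^sup>2 \<le> exp (- Re l * t\<^sup>2)"
      by (rule exp_ge_add_one_self)
    also have "\<dots> = cmod (gauss_laplace \<tau> (\<i> * t) 0)"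
      by (simp add: laplace power_mult_distrib)
    also have "\<dots> \<le> C"
      unfolding gauss_laplace_def C_def
      using integral_norm_bound[of gauss "\<lambda>u. \<tau> u * exp (2 * (\<i> * t) * Re u + 2 * 0 * Im u)"]
      by (simp add: norm_mult)
    finally show ?thesis .
  qed
  have "C \<ge> 0" unfolding C_def by simp
  then have "(sqrt (C / - Re l))\<^sup>2 = C / - Re l"
    using neg by (intro real_sqrt_pow2) (simp add: divide_nonneg_neg)
  \<comment> \<open>At \<open>t\<^sup>2 = C / - Re l\<close> the lower bound is \<open>1 + C\<close>.\<close>
  then show False
    using neg le[of "sqrt (C / - Re l)"] by simp
qed

text \<open>
  The operator acts as the dilation \<open>f(z) \<mapsto> f(l z)\<close> on coherent states. Its matrix element
  between two coherent states of radius \<open>\<bar>t\<bar>\<close> whose phases differ so as to cancel that of \<open>l\<close>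
  is \<open>exp (\<bar>l\<bar> t\<^sup>2)\<close>, whereas the product of the norms of the two states is \<open>exp (t\<^sup>2)\<close>.
\<close>

lemma cmod_le_one_of_toeplitz_coherent:
  assumes A: "bounded_fock_operator A"
    and toeplitz: "is_toeplitz \<tau>"
    and eq: "equals_toeplitz A \<tau>"
    and laplace: "\<And>x y. gauss_laplace \<tau> x y = exp (l * (x\<^sup>2 + y\<^sup>2))"
  shows "cmod l \<le> 1"
proof (rule ccontr)
  assume gt: "\<not> cmod l \<le> 1"
  obtain C where fock: "\<And>f. f \<in> fock \<Longrightarrow> A f \<in> fock"
    and C: "\<And>f. f \<in> fock \<Longrightarrow> norm2 (A f) \<le> C * norm2 f"
    using A unfolding bounded_fock_operator_def by blast
  have "1 + (cmod l - 1) * t\<^sup>2 \<le> C" for t :: real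
  proof -
    define w where "w = complex_of_real t"
    define z where "z = complex_of_real t * (cnj l / cmod l)"
    have norm: "cmod w = \<bar>t\<bar>" "cmod z = \<bar>t\<bar>"
      using gt by (auto simp: w_def z_def norm_mult norm_divide)
    have "l * (cnj l / cmod l) = cmod l"
      using gt by (simp flip: complex_norm_square add: power2_eq_square)
    moreover have "l * (cnj w * z) = (l * (cnj l / cmod l)) * of_real (t\<^sup>2)"
      by (simp add: w_def z_def power2_eq_square mult_ac)
    ultimately have lz: "l * (cnj w * z) = of_real (cmod l * t\<^sup>2)"
      by simp
    have Aw: "A (coherent w) = toeplitz \<tau> (coherent w)" and w: "coherent w \<in> fock"
      using toeplitz eq by (auto simp: is_toeplitz_def equals_toeplitz_def toeplitz_dom_def)
    have "((cnj w + z) / 2)\<^sup>2 + (\<i> * (cnj w - z) / 2)\<^sup>2 = cnj w * z"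
      by (simp add: power2_eq_square field_simps)
    then have "exp (cmod l * t\<^sup>2) = cmod (L2_inner (A (coherent w)) (coherent z))"
      by (simp add: Aw L2_inner_toeplitz_coherent[OF toeplitz] toeplitz_coherent_eq_gauss_laplace laplace lz)
    also have "\<dots> \<le> norm2 (A (coherent w)) * norm2 (coherent z)"
      using fock[OF w] by (intro norm_L2_inner_le L2_coherent) (auto simp: fock_def)
    also have "\<dots> \<le> C * norm2 (coherent w) * norm2 (coherent z)"
      by (intro mult_right_mono C w) (simp add: norm2_coherent)
    also have "\<dots> = C * exp (t\<^sup>2)"
      by (simp add: norm2_coherent norm mult.assoc exp_add[symmetric])
    finally have "exp ((cmod l - 1) * t\<^sup>2) \<le> C"
      by (simp add: left_diff_distrib exp_diff field_simps)
    then show ?thesis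
      using exp_ge_add_one_self[of "(cmod l - 1) * t\<^sup>2"] by linarith
  qed
  \<comment> \<open>\<open>t = 0\<close> gives \<open>C \<ge> 1\<close>, so the square root is real; there the lower bound is \<open>1 + C\<close>.\<close>
  from this[of 0] this[of "sqrt (C / (cmod l - 1))"] gt show False
    by simp
qed

theorem theorem9:
  fixes \<theta> :: complex
    and A :: "(complex \<Rightarrow> complex) \<Rightarrow> (complex \<Rightarrow> complex)"
  assumes "bounded_fock_operator A"
    and "\<And>z. wick_symbol A (cnj z) z = exp (- \<theta> * complex_of_real ((cmod z)\<^sup>2))"
  shows "((cmod \<theta>)\<^sup>2 = 2 * Re \<theta> \<and> Re \<theta> > 1 \<longrightarrow>
           \<not> (\<exists>\<tau>. bounded_toeplitz \<tau> \<and> equals_toeplitz A \<tau>)) \<and>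
         ((cmod \<theta>)\<^sup>2 > 2 * Re \<theta> \<longrightarrow>
           \<not> (\<exists>a\<in>L1_infty. bounded_toeplitz (radial a) \<and> equals_toeplitz A (radial a)))"
proof -
  have "Re \<theta> \<le> 1 \<and> (cmod \<theta>)\<^sup>2 \<le> 2 * Re \<theta>"
    if "bounded_toeplitz \<tau>" and eq: "equals_toeplitz A \<tau>" for \<tau>
  proof -
    have toeplitz: "is_toeplitz \<tau>"
      using that by (simp add: bounded_toeplitz_def)
    note laplace = toeplitz_wick_gaussian_symbol[OF assms(2) toeplitz eq]
    have "Re (1 - \<theta>) \<ge> 0"
      by (rule Re_nonneg_of_gauss_laplace) (rule laplace)
    moreover have "(cmod (1 - \<theta>))\<^sup>2 \<le> 1"
      using cmod_le_one_of_toeplitz_coherent[OF assms(1) toeplitz eq laplace] by (simp add: power_le_one)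
    ultimately show ?thesis
      unfolding cmod_power2 by (simp add: power2_eq_square algebra_simps)
  qed
  then show ?thesis
    by force
qed

end
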